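(* Let $G=(V,E)$ be a simple connected undirected graph with $n\ge 3$ vertices and vertex degrees $d_1,\dots,d_n$, and let $\lambda_1\ge\lambda_2\ge\dots\ge\lambda_n=0$ be the eigenvalues of its normalized Laplacian matrix. Put $b=n+2\sum_{(i,j)\in E}\frac{1}{d_id_j}$ and suppose $b\neq \frac{n^2}{n-1}$. Then $$\lambda_2\ \ge\ R:=\frac{1}{n-1}\left(n-\sqrt{\frac{b(n-1)-n^{2}}{n-2}}\right).$$
   Context: The normalized Laplacian of $G$ is $\mathcal{L}(G)=D^{-1/2}(D-A)D^{-1/2}$, where $A$ is the adjacency matrix of $G$ and $D$ is the diagonal matrix of vertex degrees. The sum over $(i,j)\in E$ counts each undirected edge once. *)

theory Defs
  imports
    "Graph_Theory.Digraph_Component"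
    "Jordan_Normal_Form.Char_Poly"
    "HOL-Computational_Algebra.Polynomial"
    "HOL-Library.Multiset"
    "Complex_Main"
begin

text \<open>
  A simple undirected graph is an instance of the locale \<^locale>\<open>graph\<close>: a finite symmetric
  digraph without loops and multiple arcs, so an undirected edge is a pair of opposite arcs
  and the degree of a vertex is its out-degree.
\<close>

definition deg :: "('a, 'b) pre_digraph \<Rightarrow> 'a \<Rightarrow> real" where
  "deg G v = real (out_degree G v)"

definition undirected_edges :: "('a, 'b) pre_digraph \<Rightarrow> 'a set set" where
  "undirected_edges G = {{u, v} | u v. u \<rightarrow>\<^bsub>G\<^esub> v}"

text \<open>Matrices are taken with respect to an enumeration \<open>vs\<close> of the vertices.\<close>

definition adjacency_mat :: "('a, 'b) pre_digraph \<Rightarrow> 'a list \<Rightarrow> real mat" where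
  "adjacency_mat G vs =
     mat (length vs) (length vs) (\<lambda>(i, j). if vs ! i \<rightarrow>\<^bsub>G\<^esub> vs ! j then 1 else 0)"

definition degree_mat :: "('a, 'b) pre_digraph \<Rightarrow> 'a list \<Rightarrow> real mat" where
  "degree_mat G vs =
     mat (length vs) (length vs) (\<lambda>(i, j). if i = j then deg G (vs ! i) else 0)"

text \<open>This is $D^{-1/2}$ when all degrees are positive, as in a connected graph
  with at least two vertices.\<close>

definition degree_inv_sqrt_mat :: "('a, 'b) pre_digraph \<Rightarrow> 'a list \<Rightarrow> real mat" where
  "degree_inv_sqrt_mat G vs =
     mat (length vs) (length vs) (\<lambda>(i, j). if i = j then 1 / sqrt (deg G (vs ! i)) else 0)"

definition normalized_laplacian :: "('a, 'b) pre_digraph \<Rightarrow> 'a list \<Rightarrow> real mat" where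
  "normalized_laplacian G vs =
     degree_inv_sqrt_mat G vs * (degree_mat G vs - adjacency_mat G vs) * degree_inv_sqrt_mat G vs"

text \<open>The real eigenvalues in non-increasing order, repeated according to algebraic multiplicity.
  The list is indexed from 0, so $\lambda_k$ is its entry number $k - 1$.\<close>

definition eigenvalues_desc :: "real mat \<Rightarrow> real list" where
  "eigenvalues_desc A = rev (sorted_list_of_multiset (proots (char_poly A)))"

end

theory Submission
  imports Defs "Jordan_Normal_Form.Schur_Decomposition"
begin

text \<open>
  The normalized Laplacian $L$ is real symmetric, hence triangularizable over the reals, and so its
  eigenvalues have sum $\mathrm{tr}\, L = n$ and sum of squares $\mathrm{tr}\, L^2 = b$. The vector
  of the square roots of the degrees shows that $0$ is an eigenvalue. Discarding it leaves $n - 1$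
  reals of mean $\mu = n / (n - 1)$, all but the largest of which are at most $\lambda_2$. If
  $\lambda_2 < \mu$, each of these $n - 2$ numbers lies at least $\mu - \lambda_2$ below the mean,
  so the largest lies at least $(n - 2)(\mu - \lambda_2)$ above it, and comparing with the variance
  bounds $\mu - \lambda_2$.
\<close>

section \<open>Trace under similarity, and squares of triangular matrices\<close>

definition mat_trace :: "'a :: comm_monoid_add mat \<Rightarrow> 'a" where
  "mat_trace A = (\<Sum>i<dim_row A. A $$ (i, i))"

lemma mat_trace_mult_comm:
  fixes A B :: "'a :: comm_semiring_1 mat"
  assumes "A \<in> carrier_mat n m" "B \<in> carrier_mat m n"
  shows "mat_trace (A * B) = mat_trace (B * A)"
proof -
  have "mat_trace (A * B) = (\<Sum>i<n. \<Sum>j<m. A $$ (i, j) * B $$ (j, i))"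
    using assms by (auto simp: mat_trace_def scalar_prod_def lessThan_atLeast0 intro!: sum.cong)
  also have "\<dots> = (\<Sum>j<m. \<Sum>i<n. B $$ (j, i) * A $$ (i, j))"
    by (subst sum.swap) (simp add: mult.commute)
  also have "\<dots> = mat_trace (B * A)"
    using assms by (auto simp: mat_trace_def scalar_prod_def lessThan_atLeast0 intro!: sum.cong)
  finally show ?thesis .
qed

text \<open>With \<open>A = P * B * Q\<close>, cyclicity of the trace moves \<open>P\<close> to the
  far right, where \<open>Q * P\<close> cancels.\<close>

lemma mat_trace_similar:
  fixes A B :: "'a :: comm_semiring_1 mat"
  assumes "A \<in> carrier_mat n n" and "similar_mat_wit A B P Q"
  shows "mat_trace A = mat_trace B"
proof -
  note w = similar_mat_witD2[OF assms]
  have "mat_trace A = mat_trace (P * (B * Q))"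
    using w by (simp add: assoc_mult_mat[of P n n B n Q n])
  also have "\<dots> = mat_trace (B * Q * P)"
    using w by (intro mat_trace_mult_comm[of _ n n]) auto
  also have "B * Q * P = B"
    using w by (simp add: assoc_mult_mat[of B n n Q n P n])
  finally show ?thesis .
qed

text \<open>For \<open>j \<noteq> i\<close> one of the entries at \<open>(i, j)\<close> and
  \<open>(j, i)\<close> lies below the diagonal, so only the term \<open>j = i\<close>
  survives.\<close>

lemma upper_triangular_square_diag:
  fixes B :: "'a :: comm_semiring_1 mat"
  assumes "B \<in> carrier_mat n n" "upper_triangular B" "i < n"
  shows "(B * B) $$ (i, i) = (B $$ (i, i))\<^sup>2"
proof -
  have "(B * B) $$ (i, i) = (\<Sum>j<n. B $$ (i, j) * B $$ (j, i))"
    using assms by (auto simp: scalar_prod_def lessThan_atLeast0 intro!: sum.cong)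
  also have "\<dots> = (\<Sum>j<n. if j = i then (B $$ (i, i))\<^sup>2 else 0)"
  proof (rule sum.cong)
    fix j assume "j \<in> {..<n}"
    then show "B $$ (i, j) * B $$ (j, i) = (if j = i then (B $$ (i, i))\<^sup>2 else 0)"
      using assms by (cases i j rule: linorder_cases) (auto simp: upper_triangular_def power2_eq_square)
  qed simp
  also have "\<dots> = (B $$ (i, i))\<^sup>2"
    using assms by simp
  finally show ?thesis .
qed

section \<open>Spectra of real symmetric matrices\<close>

text \<open>For an eigenvector \<open>v\<close>, the Hermitian form of \<open>A\<close> at
  \<open>v\<close> equals \<open>a\<close> times the squared norm of \<open>v\<close>. Symmetry
  makes the form real, so \<open>a\<close> is a quotient of reals.\<close>

lemma real_symmetric_eigenvalue_real:
  fixes A :: "real mat"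
  assumes A: "A \<in> carrier_mat n n"
    and sym: "\<And>i j. i < n \<Longrightarrow> j < n \<Longrightarrow> A $$ (i, j) = A $$ (j, i)"
    and ev: "eigenvalue (map_mat complex_of_real A) a"
  shows "a \<in> \<real>"
proof -
  obtain v where v: "v \<in> carrier_vec n" "v \<noteq> 0\<^sub>v n"
    and Av: "map_mat complex_of_real A *\<^sub>v v = a \<cdot>\<^sub>v v"
    using ev A by (auto simp: eigenvalue_def eigenvector_def)
  have row: "(\<Sum>j<n. of_real (A $$ (i, j)) * v $ j) = a * v $ i" if "i < n" for i
  proof -
    have "(map_mat complex_of_real A *\<^sub>v v) $ i = (a \<cdot>\<^sub>v v) $ i"
      by (simp add: Av)
    then show ?thesis
      using that A v by (simp add: scalar_prod_def lessThan_atLeast0)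
  qed
  define q where "q = (\<Sum>i<n. \<Sum>j<n. cnj (v $ i) * (of_real (A $$ (i, j)) * v $ j))"
  define s where "s = (\<Sum>i<n. (cmod (v $ i))\<^sup>2)"
  have "q = (\<Sum>i<n. cnj (v $ i) * (a * v $ i))"
    unfolding q_def by (simp add: row flip: sum_distrib_left)
  also have "\<dots> = a * of_real s"
    by (simp add: s_def sum_distrib_left complex_norm_square ac_simps del: of_real_power)
  finally have q: "q = a * of_real s" .
  \<comment> \<open>Conjugation fixes the real entries of \<open>A\<close> and exchanges the roles
    of the two indices; symmetry then restores \<open>q\<close>.\<close>
  have "cnj q = (\<Sum>j<n. \<Sum>i<n. v $ i * (of_real (A $$ (i, j)) * cnj (v $ j)))"
    unfolding q_def by (subst sum.swap) simp
  also have "\<dots> = q"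
    unfolding q_def by (intro sum.cong refl) (auto simp: sym)
  finally have "q \<in> \<real>"
    by (simp add: Reals_cnj_iff)
  moreover have "s \<noteq> 0"
  proof
    assume "s = 0"
    then have "\<forall>i<n. v $ i = 0"
      by (simp add: s_def sum_nonneg_eq_0_iff)
    then have "v = 0\<^sub>v n"
      using v by (intro eq_vecI) auto
    with v show False by simp
  qed
  ultimately show ?thesis
    using q by (metis Reals_divide Reals_of_real nonzero_mult_div_cancel_right of_real_eq_0_iff)
qed

text \<open>The characteristic polynomial splits over the complex numbers with real roots only, so
  the factorization descends to the reals. A real Schur decomposition needs this list of
  roots.\<close>

lemma real_symmetric_char_poly_factorized:
  fixes A :: "real mat"
  assumes A: "A \<in> carrier_mat n n"
    and sym: "\<And>i j. i < n \<Longrightarrow> j < n \<Longrightarrow> A $$ (i, j) = A $$ (j, i)"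
  shows "\<exists>rs. char_poly A = (\<Prod>r\<leftarrow>rs. [:- r, 1:])"
proof -
  let ?C = "map_mat complex_of_real A"
  have C: "?C \<in> carrier_mat n n"
    using A by simp
  obtain as where as: "char_poly ?C = (\<Prod>a\<leftarrow>as. [:- a, 1:])"
    using char_poly_factorized[OF C] by blast
  have "a \<in> \<real>" if "a \<in> set as" for a
  proof (rule real_symmetric_eigenvalue_real[OF A sym])
    have "poly (char_poly ?C) a = 0"
      using that unfolding as by (force simp: poly_prod_list prod_list_zero_iff)
    then show "eigenvalue ?C a"
      by (simp add: eigenvalue_root_char_poly[OF C])
  qed
  then have re: "map (\<lambda>a. complex_of_real (Re a)) as = as"
    by (intro map_idI) simp
  interpret map_poly_inj_idom_hom complex_of_real ..
  have "map_poly complex_of_real (char_poly A) = char_poly ?C"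
    by (rule of_real_hom.char_poly_hom[OF A, symmetric])
  also have "\<dots> = (\<Prod>a\<leftarrow>map (\<lambda>a. complex_of_real (Re a)) as. [:- a, 1:])"
    by (simp only: re as)
  also have "\<dots> = map_poly complex_of_real (\<Prod>r\<leftarrow>map Re as. [:- r, 1:])"
    by (simp add: hom_prod_list o_def hom_distribs)
  finally have "char_poly A = (\<Prod>r\<leftarrow>map Re as. [:- r, 1:])"
    by simp
  then show ?thesis by blast
qed

lemma eigenvalues_desc_sorted: "sorted_wrt (\<ge>) (eigenvalues_desc A)"
  by (simp add: eigenvalues_desc_def sorted_wrt_rev)

lemma set_eigenvalues_desc:
  assumes "A \<in> carrier_mat n n"
  shows "k \<in> set (eigenvalues_desc A) \<longleftrightarrow> eigenvalue A k"
proof -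
  \<comment> \<open>\<open>proots\<close> records the roots faithfully only for a nonzero
    polynomial; this one is monic.\<close>
  have "char_poly A \<noteq> 0"
    using degree_monic_char_poly[OF assms] by auto
  then show ?thesis
    by (simp add: eigenvalues_desc_def eigenvalue_root_char_poly[OF assms])
qed

text \<open>Schur decomposition gives a similar triangular matrix with the eigenvalues on its
  diagonal. Both power sums are then traces, of \<open>A\<close> and of \<open>A * A\<close>, by
  similarity invariance.\<close>

lemma real_symmetric_eigenvalues_desc:
  fixes A :: "real mat"
  assumes A: "A \<in> carrier_mat n n"
    and sym: "\<And>i j. i < n \<Longrightarrow> j < n \<Longrightarrow> A $$ (i, j) = A $$ (j, i)"
  shows "length (eigenvalues_desc A) = n"
    and "sum_list (eigenvalues_desc A) = (\<Sum>i<n. A $$ (i, i))"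
    and "(\<Sum>x\<leftarrow>eigenvalues_desc A. x\<^sup>2) = (\<Sum>i<n. \<Sum>j<n. (A $$ (i, j))\<^sup>2)"
proof -
  obtain rs where rs: "char_poly A = (\<Prod>r\<leftarrow>rs. [:- r, 1:])"
    using real_symmetric_char_poly_factorized[OF A sym] by blast
  have "proots (char_poly A) = mset rs"
    unfolding rs
  proof (induction rs)
    case (Cons a rs)
    have "(\<Prod>r\<leftarrow>rs. [:- r, 1:]) \<noteq> 0"
      by (auto simp: prod_list_zero_iff)
    then show ?case
      using Cons proots_mult[of "[:- a, 1:]" "\<Prod>r\<leftarrow>rs. [:- r, 1:]"] by simp
  qed simp
  then have ms: "mset (eigenvalues_desc A) = mset rs"
    by (simp add: eigenvalues_desc_def)
  obtain B P Q where "schur_decomposition A rs = (B, P, Q)"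
    by (metis prod_cases3)
  from schur_decomposition[OF A rs this]
  have sim: "similar_mat_wit A B P Q" and ut: "upper_triangular B" and dg: "diag_mat B = rs"
    by auto
  have B: "B \<in> carrier_mat n n"
    using similar_mat_witD2[OF A sim] by auto
  have rs': "rs = map (\<lambda>i. B $$ (i, i)) [0..<n]"
    using dg B by (auto simp: diag_mat_def)
  \<comment> \<open>Such sums depend only on the multiset of roots, so the sorted list may be
    replaced by the diagonal of \<open>B\<close>.\<close>
  have sum_ev: "(\<Sum>x\<leftarrow>eigenvalues_desc A. f x) = (\<Sum>i<n. f (B $$ (i, i)))" for f :: "real \<Rightarrow> real"
  proof -
    have "(\<Sum>x\<leftarrow>eigenvalues_desc A. f x) = (\<Sum>x\<leftarrow>rs. f x)"
      by (metis ms mset_map sum_mset_sum_list)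
    then show ?thesis
      by (simp add: rs' o_def interv_sum_list_conv_sum_set_nat lessThan_atLeast0)
  qed
  show "length (eigenvalues_desc A) = n"
    using mset_eq_length[OF ms] by (simp add: rs')
  have "sum_list (eigenvalues_desc A) = mat_trace B"
    using sum_ev[of "\<lambda>x. x"] B by (simp add: mat_trace_def)
  then show "sum_list (eigenvalues_desc A) = (\<Sum>i<n. A $$ (i, i))"
    using mat_trace_similar[OF A sim] A by (simp add: mat_trace_def)
  have sim2: "similar_mat_wit (A * A) (B * B) P Q"
    using similar_mat_wit_pow[OF sim, of 2] A B by (simp add: numeral_2_eq_2)
  have "(\<Sum>x\<leftarrow>eigenvalues_desc A. x\<^sup>2) = mat_trace (B * B)"
    using sum_ev[of "\<lambda>x. x\<^sup>2"] B upper_triangular_square_diag[OF B ut] by (simp add: mat_trace_def)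
  also have "\<dots> = mat_trace (A * A)"
    using mat_trace_similar[OF _ sim2, of n] A by simp
  \<comment> \<open>By symmetry each product of the entries at \<open>(i, j)\<close> and
    \<open>(j, i)\<close> is a square.\<close>
  also have "\<dots> = (\<Sum>i<n. \<Sum>j<n. (A $$ (i, j))\<^sup>2)"
    using A sym by (auto simp: mat_trace_def scalar_prod_def lessThan_atLeast0 power2_eq_square intro!: sum.cong)
  finally show "(\<Sum>x\<leftarrow>eigenvalues_desc A. x\<^sup>2) = (\<Sum>i<n. \<Sum>j<n. (A $$ (i, j))\<^sup>2)" .
qed

section \<open>A variance bound for the second largest of finitely many reals\<close>

text \<open>Put \<open>m = n - 2\<close> and let g be the gap \<open>\<mu> - t\<close>, assumed
  nonnegative. The \<open>m\<close> smaller numbers contribute at least m g^2 to the sum of squared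
  deviations, and the largest at least (m g)^2. Hence m (m + 1) g^2 is at most
  \<open>b - s^2 / (m + 1)\<close>, and solving for g gives the bound.\<close>

lemma second_largest_ge:
  fixes xs :: "real list"
  assumes srt: "sorted_wrt (\<ge>) xs" and len: "length xs = n" and n: "n \<ge> 3"
    and zero: "0 \<in> set xs"
    and sum: "sum_list xs = s" and s: "s > 0"
    and sq: "(\<Sum>x\<leftarrow>xs. x\<^sup>2) = b"
  shows "xs ! 1 \<ge> 1 / (real n - 1) * (s - sqrt ((b * (real n - 1) - s\<^sup>2) / (real n - 2)))"
proof -
  obtain h xs' where xs: "xs = h # xs'"
    using len n by (cases xs) auto
  define t where "t = xs ! 1"
  define m where "m = real n - 2"
  have m: "m \<ge> 1"
    using n by (simp add: m_def)
  have le_t: "x \<le> t" if "x \<in> set xs'" for x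
    using that srt len n by (cases xs') (auto simp: xs t_def)
  \<comment> \<open>The discarded zero must not be the head, so that the largest entry
    \<open>h\<close> survives; a zero head would force a nonpositive sum.\<close>
  have "0 \<in> set xs'"
  proof (rule ccontr)
    assume "0 \<notin> set xs'"
    with zero xs have "h = 0" by simp
    with srt xs have "\<forall>x\<in>set xs. x \<le> 0" by auto
    then have "sum_list xs \<le> 0" by (auto intro: sum_list_nonpos)
    with sum s show False by simp
  qed
  \<comment> \<open>Only one zero is dropped: \<open>ys\<close> has exactly \<open>m\<close>
    entries, and further zeros may remain.\<close>
  define ys where "ys = remove1 0 xs'"
  have ys_t: "y \<le> t" if "y \<in> set ys" for y
    using that le_t notin_set_remove1 unfolding ys_def by metis
  have ys_len: "real (length ys) = m"
    using len n \<open>0 \<in> set xs'\<close> by (simp add: ys_def xs length_remove1 m_def)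
  have "sum_list xs' = sum_list ys"
    using sum_list_map_remove1[OF \<open>0 \<in> set xs'\<close>, of "\<lambda>x. x"] by (simp add: ys_def)
  then have h: "h = s - sum_list ys"
    using sum xs by simp
  have ys_sq: "h\<^sup>2 + (\<Sum>y\<leftarrow>ys. y\<^sup>2) = b"
    using sq sum_list_map_remove1[OF \<open>0 \<in> set xs'\<close>, of "\<lambda>x. x\<^sup>2"] by (simp add: ys_def xs)
  \<comment> \<open>The mean of the \<open>m + 1\<close> numbers formed by \<open>h\<close> and
    \<open>ys\<close>.\<close>
  define \<mu> where "\<mu> = s / (m + 1)"
  have mu: "s = (m + 1) * \<mu>"
    using m by (simp add: \<mu>_def)
  have "(\<Sum>y\<leftarrow>zs. (\<mu> - y)\<^sup>2) = real (length zs) * \<mu>\<^sup>2 - 2 * \<mu> * sum_list zs + (\<Sum>y\<leftarrow>zs. y\<^sup>2)" for zs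
    by (induction zs) (simp_all add: power2_eq_square algebra_simps)
  then have "(h - \<mu>)\<^sup>2 + (\<Sum>y\<leftarrow>ys. (\<mu> - y)\<^sup>2) = b - (m + 1) * \<mu>\<^sup>2"
    unfolding ys_sq[symmetric] h mu by (simp add: ys_len power2_eq_square algebra_simps)
  then have "(m + 1) * ((h - \<mu>)\<^sup>2 + (\<Sum>y\<leftarrow>ys. (\<mu> - y)\<^sup>2)) = (m + 1) * (b - (m + 1) * \<mu>\<^sup>2)"
    by simp
  also have "\<dots> = b * (m + 1) - s\<^sup>2"
    by (simp add: mu power2_eq_square algebra_simps)
  \<comment> \<open>The radicand is (m + 1) / m times the sum of squared deviations. This form shows
    its sign and is what the estimates below bound from below.\<close>
  finally have var: "(b * (m + 1) - s\<^sup>2) / m = (m + 1) * ((h - \<mu>)\<^sup>2 + (\<Sum>y\<leftarrow>ys. (\<mu> - y)\<^sup>2)) / m"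
    by simp
  have "(m + 1) * (\<mu> - t) \<le> sqrt ((b * (m + 1) - s\<^sup>2) / m)"
  proof (cases "t \<le> \<mu>")
    case False
    \<comment> \<open>\<open>sqrt\<close> is negative at negative arguments, so the sign of the
      radicand must be settled even when \<open>t\<close> exceeds the mean.\<close>
    have "(b * (m + 1) - s\<^sup>2) / m \<ge> 0"
      unfolding var using m by (intro divide_nonneg_nonneg mult_nonneg_nonneg add_nonneg_nonneg sum_list_nonneg) auto
    moreover have "(m + 1) * (\<mu> - t) \<le> 0"
      using False m by (intro mult_nonneg_nonpos) auto
    ultimately show ?thesis
      by (meson order_trans real_sqrt_ge_zero)
  next
    case True
    \<comment> \<open>Deviations from the mean cancel: the total shortfall of \<open>ys\<close> is
      the excess of \<open>h\<close>.\<close>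
    have "(\<Sum>y\<leftarrow>ys. \<mu> - t) \<le> (\<Sum>y\<leftarrow>ys. \<mu> - y)"
      using ys_t by (intro sum_list_mono) auto
    also have "\<dots> = h - \<mu>"
      by (simp add: sum_list_subtractf sum_list_triv ys_len h mu algebra_simps)
    finally have "m * (\<mu> - t) \<le> h - \<mu>"
      by (simp add: sum_list_triv ys_len)
    then have "(m * (\<mu> - t))\<^sup>2 \<le> (h - \<mu>)\<^sup>2"
      using True m by (intro power_mono) auto
    moreover have "(\<Sum>y\<leftarrow>ys. (\<mu> - t)\<^sup>2) \<le> (\<Sum>y\<leftarrow>ys. (\<mu> - y)\<^sup>2)"
      using ys_t True by (intro sum_list_mono power_mono) auto
    then have "m * (\<mu> - t)\<^sup>2 \<le> (\<Sum>y\<leftarrow>ys. (\<mu> - y)\<^sup>2)"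
      by (simp add: sum_list_triv ys_len)
    ultimately have "(m * (\<mu> - t))\<^sup>2 + m * (\<mu> - t)\<^sup>2 \<le> (h - \<mu>)\<^sup>2 + (\<Sum>y\<leftarrow>ys. (\<mu> - y)\<^sup>2)"
      by (rule add_mono)
    then have "(m + 1) * ((m * (\<mu> - t))\<^sup>2 + m * (\<mu> - t)\<^sup>2) / m \<le> (b * (m + 1) - s\<^sup>2) / m"
      unfolding var using m by (intro divide_right_mono mult_left_mono) auto
    moreover have "(m + 1) * ((m * (\<mu> - t))\<^sup>2 + m * (\<mu> - t)\<^sup>2) / m = ((m + 1) * (\<mu> - t))\<^sup>2"
      using m by (simp add: power2_eq_square field_simps)
    ultimately show ?thesis
      by (intro real_le_rsqrt) simp
  qed
  then have "s - sqrt ((b * (m + 1) - s\<^sup>2) / m) \<le> (m + 1) * t"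
    by (simp add: mu algebra_simps)
  then have "1 / (m + 1) * (s - sqrt ((b * (m + 1) - s\<^sup>2) / m)) \<le> t"
    using m by (simp add: field_simps)
  then show ?thesis
    by (simp add: t_def m_def)
qed

section \<open>Degrees, arcs and undirected edges\<close>

lemma (in loopfree_digraph) not_dominates_self: "\<not> v \<rightarrow>\<^bsub>G\<^esub> v"
  using no_loops by (auto simp: arcs_ends_def arc_to_ends_def)

lemma (in graph) dominates_sym: "u \<rightarrow>\<^bsub>G\<^esub> v \<longleftrightarrow> v \<rightarrow>\<^bsub>G\<^esub> u"
  using sym_arcs by (auto simp: symmetric_def sym_def)

text \<open>Without parallel arcs, \<open>head\<close> is injective on the arcs leaving
  \<open>u\<close>. This links degrees, which count arcs, to row sums of the adjacency matrix, which
  count neighbours.\<close>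

lemma (in nomulti_digraph) out_degree_eq_card_dominates:
  "out_degree G u = card {v. u \<rightarrow>\<^bsub>G\<^esub> v}"
proof -
  have "inj_on (head G) (out_arcs G u)"
    by (rule inj_onI, rule no_multi_arcs) (auto simp: arc_to_ends_def)
  moreover have "head G ` out_arcs G u = {v. u \<rightarrow>\<^bsub>G\<^esub> v}"
    by (auto simp: arcs_ends_def arc_to_ends_def)
  ultimately show ?thesis
    unfolding out_degree_def by (metis card_image)
qed

text \<open>Some walk leads from \<open>u\<close> to another vertex, and its first arc leaves
  \<open>u\<close>.\<close>

lemma (in graph) connected_deg_pos:
  assumes "connected G" and "card (verts G) \<ge> 2" and u: "u \<in> verts G"
  shows "deg G u > 0"
proof -
  have "\<not> verts G \<subseteq> {u}"
    using assms(2) card_mono[of "{u}" "verts G"] by auto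
  then obtain v where v: "v \<in> verts G" "v \<noteq> u"
    by blast
  have "strongly_connected G"
    using assms(1) by (rule symmetric_connected_imp_strongly_connected[OF sym_arcs])
  then have "u \<rightarrow>\<^sup>*\<^bsub>G\<^esub> v"
    using u v by auto
  then have "u \<rightarrow>\<^sup>+\<^bsub>G\<^esub> v"
    using v by (intro reachable_neq_reachable1) auto
  then obtain w where "u \<rightarrow>\<^bsub>G\<^esub> w"
    by (meson tranclD)
  then have "out_arcs G u \<noteq> {}"
    by (auto simp: arcs_ends_def arc_to_ends_def)
  then show ?thesis
    by (simp add: deg_def out_degree_def card_gt_0_iff finite_out_arcs)
qed

text \<open>Forgetting direction maps exactly two ordered pairs, of equal weight, onto each
  undirected edge.\<close>

lemma (in graph) sum_arcs_ends_eq_sum_undirected_edges: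
  fixes f :: "'a \<Rightarrow> real"
  shows "(\<Sum>(u, v)\<in>arcs_ends G. 1 / (f u * f v)) =
    2 * (\<Sum>e\<in>undirected_edges G. 1 / (\<Prod>v\<in>e. f v))"
proof -
  have fin: "finite (arcs_ends G)"
    by (simp add: arcs_ends_def)
  have img: "(\<lambda>(u, v). {u, v}) ` arcs_ends G = undirected_edges G"
    by (auto simp: undirected_edges_def)
  have "(\<Sum>(u, v)\<in>arcs_ends G. 1 / (f u * f v)) =
    (\<Sum>e\<in>undirected_edges G. \<Sum>(u, v)\<in>{p \<in> arcs_ends G. (case p of (u, v) \<Rightarrow> {u, v}) = e}. 1 / (f u * f v))"
    by (rule sum.image_gen[OF fin, of _ "\<lambda>(u, v). {u, v}", unfolded img])
  also have "\<dots> = (\<Sum>e\<in>undirected_edges G. 2 * (1 / (\<Prod>v\<in>e. f v)))"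
  proof (rule sum.cong[OF refl])
    fix e assume "e \<in> undirected_edges G"
    then obtain u v where e: "e = {u, v}" "(u, v) \<in> arcs_ends G"
      unfolding undirected_edges_def by blast
    have "{p \<in> arcs_ends G. (case p of (u, v) \<Rightarrow> {u, v}) = e} = {(u, v), (v, u)}"
      using e dominates_sym by (auto simp: doubleton_eq_iff)
    \<comment> \<open>Distinct ends are needed twice: for a fibre of size two, and for two factors
      in the product over \<open>e\<close>.\<close>
    moreover have "u \<noteq> v"
      using e not_dominates_self by auto
    ultimately show "(\<Sum>(u, v)\<in>{p \<in> arcs_ends G. (case p of (u, v) \<Rightarrow> {u, v}) = e}. 1 / (f u * f v)) = 2 * (1 / (\<Prod>v\<in>e. f v))"
      using e \<open>u \<noteq> v\<close> by (simp add: mult.commute)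
  qed
  finally show ?thesis
    by (simp add: sum_distrib_left)
qed

section \<open>Entries, kernel and sum of squares of the normalized Laplacian\<close>

lemma normalized_laplacian_carrier:
  "normalized_laplacian G vs \<in> carrier_mat (length vs) (length vs)"
  by (simp add: normalized_laplacian_def degree_inv_sqrt_mat_def degree_mat_def adjacency_mat_def
      carrier_matI)

text \<open>A diagonal factor scales rows from the left and columns from the right.\<close>

lemma diag_mult_mat_mult_diag:
  fixes M :: "'a :: comm_semiring_1 mat" and d :: "nat \<Rightarrow> 'a"
  assumes "M \<in> carrier_mat n n" and "i < n" "j < n"
  defines "D \<equiv> mat n n (\<lambda>(i, j). if i = j then d i else 0)"
  shows "(D * M * D) $$ (i, j) = d i * M $$ (i, j) * d j"
proof -
  have D: "D \<in> carrier_mat n n" by (simp add: D_def)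
  have DM: "(D * M) $$ (i, k) = d i * M $$ (i, k)" if "k < n" for k
    using assms(1,2) that
    by (simp add: D_def scalar_prod_def if_distrib[of "\<lambda>x. x * _"] cong: if_cong)
  have Dkj: "D $$ (k, j) = (if k = j then d j else 0)" if "k < n" for k
    using assms(3) that by (simp add: D_def)
  have "(D * M * D) $$ (i, j) = (\<Sum>k = 0..<n. (D * M) $$ (i, k) * D $$ (k, j))"
    using assms(1-3) D by (simp add: scalar_prod_def del: assoc_mult_mat)
  also have "\<dots> = (\<Sum>k = 0..<n. if k = j then d i * M $$ (i, k) * d j else 0)"
    using assms(2,3) by (intro sum.cong refl) (auto simp: DM Dkj)
  finally show ?thesis
    using assms(3) by simp
qed

lemma sum_nth_distinct:
  assumes "distinct vs"
  shows "(\<Sum>i<length vs. f (vs ! i)) = sum f (set vs)"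
  using sum.reindex_bij_betw[OF bij_betw_nth[OF assms refl refl]] .

context
  fixes G :: "('a, 'b) pre_digraph" and vs :: "'a list"
  assumes graph: "graph G" and vs: "distinct vs" "set vs = verts G"
    and pos: "\<And>v. v \<in> verts G \<Longrightarrow> deg G v > 0"
begin

interpretation graph G by (rule graph)

lemma normalized_laplacian_index:
  assumes i: "i < length vs" and j: "j < length vs"
  shows "normalized_laplacian G vs $$ (i, j) =
    (if i = j then 1
     else if vs ! i \<rightarrow>\<^bsub>G\<^esub> vs ! j then - 1 / (sqrt (deg G (vs ! i)) * sqrt (deg G (vs ! j)))
     else 0)"
proof -
  have p: "deg G (vs ! i) > 0"
    using nth_mem[OF i] vs(2) by (intro pos) simp
  have "normalized_laplacian G vs $$ (i, j) = 1 / sqrt (deg G (vs ! i)) *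
      (degree_mat G vs - adjacency_mat G vs) $$ (i, j) * (1 / sqrt (deg G (vs ! j)))"
    unfolding normalized_laplacian_def degree_inv_sqrt_mat_def
    by (rule diag_mult_mat_mult_diag[OF _ i j]) (simp add: degree_mat_def adjacency_mat_def carrier_matI)
  then show ?thesis
    using i j p by (cases "i = j") (simp_all add: degree_mat_def adjacency_mat_def not_dominates_self)
qed

lemma normalized_laplacian_symmetric:
  assumes "i < length vs" "j < length vs"
  shows "normalized_laplacian G vs $$ (i, j) = normalized_laplacian G vs $$ (j, i)"
  using assms dominates_sym by (auto simp: normalized_laplacian_index)

text \<open>The rows of D - A sum to zero, so D - A kills the all-ones vector and the normalized
  Laplacian kills its image \<open>x\<close> under D^(1/2).\<close>

lemma normalized_laplacian_eigenvalue_0: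
  assumes "verts G \<noteq> {}"
  shows "eigenvalue (normalized_laplacian G vs) 0"
proof -
  let ?L = "normalized_laplacian G vs" and ?n = "length vs"
  have L: "?L \<in> carrier_mat ?n ?n"
    by (rule normalized_laplacian_carrier)
  define x where "x = vec ?n (\<lambda>i. sqrt (deg G (vs ! i)))"
  have posi: "deg G (vs ! i) > 0" if "i < ?n" for i
    using nth_mem[OF that] vs(2) by (intro pos) simp
  have row: "(\<Sum>j<?n. ?L $$ (i, j) * x $ j) = 0" if i: "i < ?n" for i
  proof -
    let ?d = "deg G (vs ! i)"
    \<comment> \<open>The factor \<open>x $ j\<close> cancels the square root at \<open>j\<close>,
      so each neighbour subtracts the same amount \<open>1 / sqrt ?d\<close>, and there are
      \<open>?d\<close> of them.\<close>
    have "(\<Sum>j<?n. ?L $$ (i, j) * x $ j) =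
      (\<Sum>j<?n. (if j = i then sqrt ?d else 0) - (if vs ! i \<rightarrow>\<^bsub>G\<^esub> vs ! j then 1 / sqrt ?d else 0))"
    proof (rule sum.cong[OF refl])
      fix j assume "j \<in> {..<?n}"
      then show "?L $$ (i, j) * x $ j =
        (if j = i then sqrt ?d else 0) - (if vs ! i \<rightarrow>\<^bsub>G\<^esub> vs ! j then 1 / sqrt ?d else 0)"
        using i posi[of j] by (simp add: normalized_laplacian_index not_dominates_self x_def)
    qed
    also have "\<dots> = sqrt ?d - (\<Sum>v\<in>verts G. if vs ! i \<rightarrow>\<^bsub>G\<^esub> v then 1 / sqrt ?d else 0)"
      using i sum_nth_distinct[OF vs(1), of "\<lambda>v. if vs ! i \<rightarrow>\<^bsub>G\<^esub> v then 1 / sqrt ?d else 0"]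
      by (simp add: sum_subtractf vs(2))
    also have "(\<Sum>v\<in>verts G. if vs ! i \<rightarrow>\<^bsub>G\<^esub> v then 1 / sqrt ?d else 0) =
        (\<Sum>v | vs ! i \<rightarrow>\<^bsub>G\<^esub> v. 1 / sqrt ?d)"
      by (rule sum.mono_neutral_cong_right) (auto intro: adj_in_verts)
    also have "\<dots> = sqrt ?d"
      by (simp add: deg_def out_degree_eq_card_dominates real_div_sqrt)
    finally show ?thesis by simp
  qed
  have "?L *\<^sub>v x = 0 \<cdot>\<^sub>v x"
    using L row by (intro eq_vecI) (auto simp: scalar_prod_def lessThan_atLeast0 x_def)
  moreover have "x \<noteq> 0\<^sub>v ?n"
  proof
    assume "x = 0\<^sub>v ?n"
    moreover have "0 < ?n" using assms vs by auto
    ultimately have "x $ 0 = 0" by simp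
    then show False using posi[OF \<open>0 < ?n\<close>] \<open>0 < ?n\<close> by (simp add: x_def)
  qed
  ultimately show ?thesis
    using L by (auto simp: eigenvalue_def eigenvector_def x_def intro!: exI[of _ x])
qed

text \<open>The unit diagonal contributes the number of vertices; the rest is a sum over ordered
  adjacent pairs, two for each edge.\<close>

lemma normalized_laplacian_sum_squares:
  "(\<Sum>i<length vs. \<Sum>j<length vs. (normalized_laplacian G vs $$ (i, j))\<^sup>2) =
    real (card (verts G)) + 2 * (\<Sum>e\<in>undirected_edges G. 1 / (\<Prod>v\<in>e. deg G v))"
proof -
  let ?n = "length vs"
  let ?f = "\<lambda>u v. (if u = v then 1 else 0) + (if u \<rightarrow>\<^bsub>G\<^esub> v then 1 / (deg G u * deg G v) else 0)"
  have "(\<Sum>i<?n. \<Sum>j<?n. (normalized_laplacian G vs $$ (i, j))\<^sup>2) =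
      (\<Sum>i<?n. \<Sum>j<?n. ?f (vs ! i) (vs ! j))"
  proof (intro sum.cong refl)
    fix i j assume "i \<in> {..<?n}" "j \<in> {..<?n}"
    \<comment> \<open>Nonnegativity makes the square of \<open>sqrt (deg G u)\<close> equal to the
      degree.\<close>
    moreover have "deg G u \<ge> 0" for u by (simp add: deg_def)
    ultimately show "(normalized_laplacian G vs $$ (i, j))\<^sup>2 = ?f (vs ! i) (vs ! j)"
      using vs(1) by (auto simp: normalized_laplacian_index not_dominates_self nth_eq_iff_index_eq power_divide power_mult_distrib)
  qed
  also have "\<dots> = (\<Sum>u\<in>verts G. \<Sum>v\<in>verts G. ?f u v)"
    by (simp only: sum_nth_distinct[OF vs(1), of "?f _"] vs(2)
        sum_nth_distinct[OF vs(1), of "\<lambda>u. \<Sum>v\<in>verts G. ?f u v"])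
  also have "\<dots> = real (card (verts G)) +
      (\<Sum>u\<in>verts G. \<Sum>v\<in>verts G. if u \<rightarrow>\<^bsub>G\<^esub> v then 1 / (deg G u * deg G v) else 0)"
    by (simp add: sum.distrib)
  also have "(\<Sum>u\<in>verts G. \<Sum>v\<in>verts G. if u \<rightarrow>\<^bsub>G\<^esub> v then 1 / (deg G u * deg G v) else 0) =
      (\<Sum>(u, v)\<in>arcs_ends G. 1 / (deg G u * deg G v))"
    unfolding sum.cartesian_product
    by (rule sum.mono_neutral_cong_right) (auto intro: adj_in_verts)
  finally show ?thesis
    by (simp add: sum_arcs_ends_eq_sum_undirected_edges)
qed

end

theorem mainTheorem2:
  fixes G :: "('a, 'b) pre_digraph" and vs :: "'a list" and n :: nat
    and ev :: "real list" and b R :: real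
  assumes "graph G" and "connected G"
    and "distinct vs" and "set vs = verts G"
    and "n = card (verts G)" and "n \<ge> 3"
    and "ev = eigenvalues_desc (normalized_laplacian G vs)"
    and "b = real n + 2 * (\<Sum>e\<in>undirected_edges G. 1 / (\<Prod>v\<in>e. deg G v))"
    and "b \<noteq> (real n)\<^sup>2 / (real n - 1)"
    and "R = 1 / (real n - 1) *
           (real n - sqrt ((b * (real n - 1) - (real n)\<^sup>2) / (real n - 2)))"
  shows "ev ! 1 \<ge> R"
proof -
  let ?L = "normalized_laplacian G vs"
  have len: "length vs = n"
    using distinct_card[OF assms(3)] assms(4,5) by simp
  \<comment> \<open>Connectedness enters here: positive degrees make
    \<open>degree_inv_sqrt_mat\<close> a genuine D^(-1/2).\<close>
  have pos: "deg G v > 0" if "v \<in> verts G" for v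
    using graph.connected_deg_pos[OF assms(1,2) _ that] assms(5,6) by simp
  note L = normalized_laplacian_carrier[of G vs]
  note eigs = real_symmetric_eigenvalues_desc[OF L normalized_laplacian_symmetric[OF assms(1,3,4) pos]]
  \<comment> \<open>All diagonal entries are 1, so the trace is \<open>n\<close>, the value of
    \<open>s\<close> in the variance bound.\<close>
  have "(\<Sum>i<length vs. ?L $$ (i, i)) = real n"
    by (simp add: normalized_laplacian_index[OF assms(1,3,4) pos] len)
  then have sum: "sum_list ev = real n"
    using eigs(2) assms(7) by simp
  have sq: "(\<Sum>x\<leftarrow>ev. x\<^sup>2) = b"
    using eigs(3) normalized_laplacian_sum_squares[OF assms(1,3,4) pos] assms(5,7,8) by simp
  have "verts G \<noteq> {}"
    using assms(5,6) by auto
  then have "0 \<in> set ev"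
    using normalized_laplacian_eigenvalue_0[OF assms(1,3,4) pos] set_eigenvalues_desc[OF L] assms(7)
    by simp
  moreover have "length ev = n"
    using eigs(1) assms(7) len by simp
  ultimately show ?thesis
    unfolding assms(10)
    using second_largest_ge[of ev n "real n" b] sum sq eigenvalues_desc_sorted[of ?L] assms(6,7) by simp
qed

end
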